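(* Let $\mathcal H$ be a complex separable infinite dimensional Hilbert space. The $C^*$-algebras $\ell_\infty(\mathbb N,\mathcal B(\mathcal H))$ and $C(\beta\mathbb N,\mathcal B(\mathcal H))$ are nonisomorphic even as Jordan algebras; that is, there is no bijective Jordan homomorphism between them.
   Context: $\mathcal B(\mathcal H)$ denotes the $C^*$-algebra of all bounded linear operators on $\mathcal H$. $\ell_\infty(\mathbb N,\mathcal B(\mathcal H))=\{(A_n)_n : A_n\in\mathcal B(\mathcal H)\ (n\in\mathbb N),\ \sup_n\|A_n\|<\infty\}$ is a $C^*$-algebra with coordinatewise operations and the supremum norm. $\beta\mathbb N$ is the Stone-Čech compactification of the discrete space $\mathbb N$, and $C(\beta\mathbb N,\mathcal B(\mathcal H))$ is the $C^*$-algebra of all continuous functions from $\beta\mathbb N$ into $\mathcal B(\mathcal H)$ (with the operator norm topology), with pointwise operations and the supremum norm. If $\mathcal R$ and $\mathcal R'$ are algebras, a linear map $\phi:\mathcal R\to\mathcal R'$ is called a Jordan homomorphism if $\phi(A)^2=\phi(A^2)$ for every $A\in\mathcal R$. *)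

theory Defs
  imports "HOL-Analysis.Analysis"
begin

section \<open>Complex vector spaces, Hilbert spaces and algebras\<close>

class scaleC =
  fixes scaleC :: "complex \<Rightarrow> 'a \<Rightarrow> 'a" (infixr "*\<^sub>C" 75)

class complex_vector = real_vector + scaleC +
  assumes scaleC_add_right: "a *\<^sub>C (x + y) = a *\<^sub>C x + a *\<^sub>C y"
    and scaleC_add_left: "(a + b) *\<^sub>C x = a *\<^sub>C x + b *\<^sub>C x"
    and scaleC_scaleC: "a *\<^sub>C b *\<^sub>C x = (a * b) *\<^sub>C x"
    and scaleC_one: "1 *\<^sub>C x = x"
    and scaleR_scaleC: "r *\<^sub>R x = complex_of_real r *\<^sub>C x"

global_interpretation complex_vector: vector_space "scaleC :: complex \<Rightarrow> 'a \<Rightarrow> 'a::complex_vector"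
  defines cspan = complex_vector.span
  by standard (rule scaleC_add_right scaleC_add_left scaleC_scaleC scaleC_one)+

class complex_normed_vector = complex_vector + real_normed_vector +
  assumes norm_scaleC: "norm (a *\<^sub>C x) = cmod a * norm x"

lemma bounded_linear_scaleC: "bounded_linear ((*\<^sub>C) a :: 'a::complex_normed_vector \<Rightarrow> 'a)"
  by (rule bounded_linear_intro[where K = "cmod a"])
     (simp_all add: scaleC_add_right scaleR_scaleC scaleC_scaleC mult.commute norm_scaleC)

class complex_algebra = complex_vector + ring +
  assumes mult_scaleC_left: "(a *\<^sub>C x) * y = a *\<^sub>C (x * y)"
    and mult_scaleC_right: "x * (a *\<^sub>C y) = a *\<^sub>C (x * y)"

class complex_normed_algebra = complex_algebra + complex_normed_vector + real_normed_algebra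

text \<open>The inner product is linear in the first argument.\<close>

class complex_inner = complex_vector + real_normed_vector +
  fixes cinner :: "'a \<Rightarrow> 'a \<Rightarrow> complex"
  assumes cinner_commute: "cinner x y = cnj (cinner y x)"
    and cinner_add_left: "cinner (x + y) z = cinner x z + cinner y z"
    and cinner_scaleC_left: "cinner (a *\<^sub>C x) y = a * cinner x y"
    and cinner_eq_norm: "cinner x x = complex_of_real ((norm x)\<^sup>2)"
begin

subclass complex_normed_vector
proof
  fix a x
  have "complex_of_real ((norm (a *\<^sub>C x))\<^sup>2) = a * cnj (a * cinner x x)"
    by (metis cinner_commute cinner_eq_norm cinner_scaleC_left)
  also have "\<dots> = complex_of_real ((cmod a * norm x)\<^sup>2)"
    by (simp add: cinner_eq_norm power_mult_distrib complex_norm_square[symmetric] flip: mult.assoc)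
  finally have "(norm (a *\<^sub>C x))\<^sup>2 = (cmod a * norm x)\<^sup>2"
    using of_real_eq_iff by blast
  then show "norm (a *\<^sub>C x) = cmod a * norm x"
    by (simp add: power2_eq_iff_nonneg)
qed

end

class chilbert_space = complex_inner + complete_space

definition jordan_homomorphism :: "('a::complex_algebra \<Rightarrow> 'b::complex_algebra) \<Rightarrow> bool" where
  "jordan_homomorphism \<phi> \<longleftrightarrow>
     Vector_Spaces.linear scaleC scaleC \<phi> \<and> (\<forall>A. \<phi> A * \<phi> A = \<phi> (A * A))"


section \<open>Bounded operators\<close>

text \<open>The library type of bounded operators only requires real linearity.\<close>

typedef (overloaded) 'a bop =
  "{T :: 'a::complex_normed_vector \<Rightarrow>\<^sub>L 'a. \<forall>a x. T (a *\<^sub>C x) = a *\<^sub>C T x}"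
  morphisms blinfun_of_bop Bop
  by (rule exI[of _ 0]) simp

setup_lifting type_definition_bop

lift_definition bop_apply :: "'a::complex_normed_vector bop \<Rightarrow> 'a \<Rightarrow> 'a" is blinfun_apply .

lemma bop_eqI: "(\<And>x. bop_apply S x = bop_apply T x) \<Longrightarrow> S = T"
  by transfer (rule blinfun_eqI)

instantiation bop :: (complex_normed_vector) complex_normed_algebra
begin

lift_definition zero_bop :: "'a bop" is 0 by simp
lift_definition plus_bop :: "'a bop \<Rightarrow> 'a bop \<Rightarrow> 'a bop" is "(+)"
  by (simp add: blinfun.add_left scaleC_add_right)
lift_definition minus_bop :: "'a bop \<Rightarrow> 'a bop \<Rightarrow> 'a bop" is "(-)"
  by (simp add: blinfun.diff_left complex_vector.scale_right_diff_distrib)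
lift_definition uminus_bop :: "'a bop \<Rightarrow> 'a bop" is uminus
  by (simp add: blinfun.minus_left)
lift_definition scaleR_bop :: "real \<Rightarrow> 'a bop \<Rightarrow> 'a bop" is "(*\<^sub>R)"
  by (simp add: blinfun.scaleR_left scaleR_scaleC scaleC_scaleC mult.commute)
lift_definition times_bop :: "'a bop \<Rightarrow> 'a bop \<Rightarrow> 'a bop" is "(o\<^sub>L)"
  by simp
lift_definition norm_bop :: "'a bop \<Rightarrow> real" is norm .

lift_definition scaleC_bop :: "complex \<Rightarrow> 'a bop \<Rightarrow> 'a bop"
  is "\<lambda>a (T :: 'a \<Rightarrow>\<^sub>L 'a). Blinfun (\<lambda>x. a *\<^sub>C T x)"
proof -
  fix a b :: complex and T :: "'a \<Rightarrow>\<^sub>L 'a" and x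
  assume T: "\<And>a x. T (a *\<^sub>C x) = a *\<^sub>C T x"
  have "bounded_linear (\<lambda>x. a *\<^sub>C T x)"
    by (rule bounded_linear_compose[OF bounded_linear_scaleC blinfun.bounded_linear_right])
  then show "Blinfun (\<lambda>x. a *\<^sub>C T x) (b *\<^sub>C x) = b *\<^sub>C Blinfun (\<lambda>x. a *\<^sub>C T x) x"
    using T by (simp add: bounded_linear_Blinfun_apply mult.commute)
qed

definition dist_bop :: "'a bop \<Rightarrow> 'a bop \<Rightarrow> real" where "dist_bop S T = norm (S - T)"
definition sgn_bop :: "'a bop \<Rightarrow> 'a bop" where "sgn_bop T = inverse (norm T) *\<^sub>R T"
definition uniformity_bop :: "('a bop \<times> 'a bop) filter" where
  "uniformity_bop = (INF e\<in>{0 <..}. principal {(S, T). dist S T < e})"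
definition open_bop :: "'a bop set \<Rightarrow> bool" where
  "open_bop U \<longleftrightarrow> (\<forall>S\<in>U. \<forall>\<^sub>F (S', T) in uniformity. S' = S \<longrightarrow> T \<in> U)"

lemma bop_apply_simps [simp]:
  "bop_apply 0 x = 0"
  "bop_apply (S + T) x = bop_apply S x + bop_apply T x"
  "bop_apply (S - T) x = bop_apply S x - bop_apply T x"
  "bop_apply (- T) x = - bop_apply T x"
  "bop_apply (r *\<^sub>R T) x = r *\<^sub>R bop_apply T x"
  "bop_apply (S * T) x = bop_apply S (bop_apply T x)"
  "bop_apply T (x + y) = bop_apply T x + bop_apply T y"
  "bop_apply T (a *\<^sub>C x) = a *\<^sub>C bop_apply T x"
  "bop_apply T (r *\<^sub>R x) = r *\<^sub>R bop_apply T x"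
  by (transfer; simp add: blinfun.bilinear_simps)+

lemma bop_apply_scaleC [simp]: "bop_apply (a *\<^sub>C T) x = a *\<^sub>C bop_apply T x"
proof transfer
  fix a x and T :: "'a \<Rightarrow>\<^sub>L 'a"
  have "bounded_linear (\<lambda>x. a *\<^sub>C T x)"
    by (rule bounded_linear_compose[OF bounded_linear_scaleC blinfun.bounded_linear_right])
  then show "Blinfun (\<lambda>x. a *\<^sub>C T x) x = a *\<^sub>C T x"
    by (simp add: bounded_linear_Blinfun_apply)
qed

lemma norm_bop_eq: "norm T = onorm (bop_apply T)"
  by transfer (rule norm_blinfun.rep_eq)

instance
proof
  fix S T U :: "'a bop" and a b :: complex and r s :: real and X :: "'a bop set"
  show "S + T + U = S + (T + U)" "S + T = T + S" "0 + T = T" "- T + T = 0" "S - T = S + - T"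
    "r *\<^sub>R (S + T) = r *\<^sub>R S + r *\<^sub>R T" "(r + s) *\<^sub>R T = r *\<^sub>R T + s *\<^sub>R T"
    "r *\<^sub>R s *\<^sub>R T = (r * s) *\<^sub>R T" "1 *\<^sub>R T = T"
    "a *\<^sub>C (S + T) = a *\<^sub>C S + a *\<^sub>C T" "(a + b) *\<^sub>C T = a *\<^sub>C T + b *\<^sub>C T"
    "a *\<^sub>C b *\<^sub>C T = (a * b) *\<^sub>C T" "1 *\<^sub>C T = T" "r *\<^sub>R T = complex_of_real r *\<^sub>C T"
    "S * T * U = S * (T * U)" "(S + T) * U = S * U + T * U" "S * (T + U) = S * T + S * U"
    "(a *\<^sub>C S) * T = a *\<^sub>C (S * T)" "S * (a *\<^sub>C T) = a *\<^sub>C (S * T)"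
    "(r *\<^sub>R S) * T = r *\<^sub>R (S * T)" "S * (r *\<^sub>R T) = r *\<^sub>R (S * T)"
    by (rule bop_eqI;
        simp add: algebra_simps scaleC_add_right scaleC_add_left scaleC_scaleC scaleC_one
          flip: scaleR_scaleC)+
  show "dist S T = norm (S - T)" "sgn T = inverse (norm T) *\<^sub>R T"
    by (simp_all add: dist_bop_def sgn_bop_def)
  show "uniformity = (INF e\<in>{0 <..}. principal {(S :: 'a bop, T). dist S T < e})"
    by (rule uniformity_bop_def)
  show "open X \<longleftrightarrow> (\<forall>S\<in>X. \<forall>\<^sub>F (S', T) in uniformity. S' = S \<longrightarrow> T \<in> X)"
    by (rule open_bop_def)
  show "norm T = 0 \<longleftrightarrow> T = 0" "norm (S + T) \<le> norm S + norm T"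
    "norm (r *\<^sub>R T) = \<bar>r\<bar> * norm T" "norm (S * T) \<le> norm S * norm T"
    by (transfer; simp add: norm_triangle_ineq norm_blinfun_compose)+
  show "norm (a *\<^sub>C T) = cmod a * norm T"
  proof (cases "a = 0")
    case True
    have "a *\<^sub>C T = 0" by (rule bop_eqI) (simp add: True)
    then show ?thesis using \<open>norm T = 0 \<longleftrightarrow> T = 0\<close> True
      by (simp add: norm_bop.rep_eq zero_bop.rep_eq)
  next
    case False
    have le: "norm (c *\<^sub>C R) \<le> cmod c * norm R" for c and R :: "'a bop"
    proof -
      have "norm (bop_apply R x) \<le> norm R * norm x" for x
        by transfer (rule norm_blinfun)
      then have "norm (bop_apply (c *\<^sub>C R) x) \<le> cmod c * norm R * norm x" for x
        by (simp add: norm_scaleC mult.assoc mult_left_mono)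
      moreover have "0 \<le> cmod c * norm R"
        by (simp add: norm_bop.rep_eq)
      ultimately show ?thesis
        unfolding norm_bop_eq[of "c *\<^sub>C R"] by (intro onorm_bound) auto
    qed
    have "T = inverse a *\<^sub>C a *\<^sub>C T"
      by (rule bop_eqI) (simp add: scaleC_scaleC scaleC_one False)
    then have "norm T \<le> cmod (inverse a) * norm (a *\<^sub>C T)"
      by (metis le)
    then have "cmod a * norm T \<le> norm (a *\<^sub>C T)"
      using False by (simp add: norm_divide field_simps)
    then show ?thesis
      using le[of a T] by simp
  qed
qed

end


section \<open>Algebras of bounded continuous functions\<close>

unbundle bcontfun.lifting

instantiation bcontfun :: (topological_space, complex_normed_algebra) complex_normed_algebra
begin

lift_definition times_bcontfun :: "('a \<Rightarrow>\<^sub>C 'b) \<Rightarrow> ('a \<Rightarrow>\<^sub>C 'b) \<Rightarrow> 'a \<Rightarrow>\<^sub>C 'b"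
  is "\<lambda>f g x. f x * g x"
proof -
  fix f g :: "'a \<Rightarrow> 'b"
  assume f: "f \<in> bcontfun" and g: "g \<in> bcontfun"
  from f g obtain B C where "\<And>x. norm (f x) \<le> B" "\<And>x. norm (g x) \<le> C"
    by (auto simp: bcontfun_def bounded_iff)
  then have "norm (f x * g x) \<le> B * C" for x
    by (meson norm_mult_ineq mult_mono' norm_ge_zero order_trans)
  then show "(\<lambda>x. f x * g x) \<in> bcontfun"
    using f g by (intro bcontfun_normI) (auto simp: bcontfun_def intro: continuous_intros)
qed

lift_definition scaleC_bcontfun :: "complex \<Rightarrow> ('a \<Rightarrow>\<^sub>C 'b) \<Rightarrow> 'a \<Rightarrow>\<^sub>C 'b"
  is "\<lambda>a f x. a *\<^sub>C f x"
proof -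
  fix a and f :: "'a \<Rightarrow> 'b"
  assume f: "f \<in> bcontfun"
  then obtain B where "\<And>x. norm (f x) \<le> B"
    by (auto simp: bcontfun_def bounded_iff)
  then have "norm (a *\<^sub>C f x) \<le> cmod a * B" for x
    by (simp add: norm_scaleC mult_left_mono)
  then show "(\<lambda>x. a *\<^sub>C f x) \<in> bcontfun"
    using f by (intro bcontfun_normI)
      (auto simp: bcontfun_def intro: bounded_linear.continuous_on[OF bounded_linear_scaleC])
qed

declare times_bcontfun.rep_eq [simp] scaleC_bcontfun.rep_eq [simp]

instance
proof
  fix f g h :: "'a \<Rightarrow>\<^sub>C 'b" and a b :: complex and r :: real
  show "a *\<^sub>C (f + g) = a *\<^sub>C f + a *\<^sub>C g" "(a + b) *\<^sub>C f = a *\<^sub>C f + b *\<^sub>C f"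
    "a *\<^sub>C b *\<^sub>C f = (a * b) *\<^sub>C f" "1 *\<^sub>C f = f" "r *\<^sub>R f = complex_of_real r *\<^sub>C f"
    "f * g * h = f * (g * h)" "(f + g) * h = f * h + g * h" "f * (g + h) = f * g + f * h"
    "(a *\<^sub>C f) * g = a *\<^sub>C (f * g)" "f * (a *\<^sub>C g) = a *\<^sub>C (f * g)"
    "(r *\<^sub>R f) * g = r *\<^sub>R (f * g)" "f * (r *\<^sub>R g) = r *\<^sub>R (f * g)"
    by (rule bcontfun_eqI;
        simp add: algebra_simps scaleC_add_right scaleC_add_left scaleC_scaleC scaleC_one
          mult_scaleC_left mult_scaleC_right flip: scaleR_scaleC)+
  show "norm (f * g) \<le> norm f * norm g"
  proof (rule norm_bound)
    fix x
    show "norm ((f * g) x) \<le> norm f * norm g"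
      by simp (meson norm_bounded norm_mult_ineq mult_mono' norm_ge_zero order_trans)
  qed
  have le: "norm (c *\<^sub>C k) \<le> cmod c * norm k" for c and k :: "'a \<Rightarrow>\<^sub>C 'b"
    by (rule norm_bound) (simp add: norm_scaleC mult_left_mono norm_bounded)
  show "norm (a *\<^sub>C f) = cmod a * norm f"
  proof (cases "a = 0")
    case True
    have "a *\<^sub>C f = 0" by (rule bcontfun_eqI) (simp add: True)
    then show ?thesis by (simp add: True)
  next
    case False
    have "f = inverse a *\<^sub>C a *\<^sub>C f"
      by (rule bcontfun_eqI) (simp add: scaleC_scaleC scaleC_one False)
    then have "norm f \<le> cmod (inverse a) * norm (a *\<^sub>C f)"
      by (metis le)
    then have "cmod a * norm f \<le> norm (a *\<^sub>C f)"
      using False by (simp add: norm_divide field_simps)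
    then show ?thesis
      using le[of a f] by simp
  qed
qed

end

text \<open>
  Since \<open>nat\<close> is discrete, the bounded continuous functions on it are exactly the bounded
  sequences; the operations are coordinatewise and the norm is the supremum norm.
\<close>

type_synonym 'b ell_infty = "nat \<Rightarrow>\<^sub>C 'b"

lemma ell_infty_carrier:
  "range (apply_bcontfun :: 'b::real_normed_vector ell_infty \<Rightarrow> nat \<Rightarrow> 'b) =
     {A. bdd_above (range (\<lambda>n. norm (A n)))}"
proof -
  have "range (apply_bcontfun :: 'b ell_infty \<Rightarrow> nat \<Rightarrow> 'b) = bcontfun"
    using type_definition.Rep_range[OF type_definition_bcontfun] .
  also have "\<dots> = {A. bdd_above (range (\<lambda>n. norm (A n)))}"
    by (auto simp: bcontfun_def bounded_iff bdd_above_def)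
  finally show ?thesis .
qed


section \<open>The Stone-Cech compactification\<close>

text \<open>
  The closure of the image of the evaluation map in the product space
  \<open>\<Prod>\<^sub>f \<real>\<close>, with \<open>f\<close> ranging over the bounded continuous real functions on the space.
\<close>

typedef (overloaded) 'a stone_cech =
  "closure (range (\<lambda>(x::'a::topological_space) (f :: 'a \<Rightarrow>\<^sub>C real). apply_bcontfun f x))"
  morphisms stone_cech_coord Abs_stone_cech
  using closure_subset by blast

instantiation stone_cech :: (topological_space) topological_space
begin

definition open_stone_cech :: "'a stone_cech set \<Rightarrow> bool" where
  "open_stone_cech U \<longleftrightarrow> (\<exists>V. open V \<and> U = stone_cech_coord -` V)"

instance
proof
  show "open (UNIV :: 'a stone_cech set)"
    unfolding open_stone_cech_def by (rule exI[of _ UNIV]) simp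
  show "open (S \<inter> T)" if "open S" "open T" for S T :: "'a stone_cech set"
    using that unfolding open_stone_cech_def by (metis open_Int vimage_Int)
  show "open (\<Union>K)" if "\<forall>S\<in>K. open S" for K :: "'a stone_cech set set"
  proof -
    from that obtain V where V: "\<And>S. S \<in> K \<Longrightarrow> open (V S) \<and> S = stone_cech_coord -` V S"
      unfolding open_stone_cech_def by metis
    then have "\<Union>K = stone_cech_coord -` (\<Union>S\<in>K. V S)" by blast
    moreover have "open (\<Union>S\<in>K. V S)" using V by blast
    ultimately show ?thesis unfolding open_stone_cech_def by blast
  qed
qed

end

definition stone_cech_embed :: "'a::topological_space \<Rightarrow> 'a stone_cech" where
  "stone_cech_embed x = Abs_stone_cech (\<lambda>f. apply_bcontfun f x)"

lemma stone_cech_coord_embed [simp]: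
  "stone_cech_coord (stone_cech_embed x) = (\<lambda>f. apply_bcontfun f x)"
  unfolding stone_cech_embed_def
  by (rule Abs_stone_cech_inverse, rule subsetD[OF closure_subset rangeI])

lemma Hausdorff_space_fun: "Hausdorff_space (euclidean :: ('i \<Rightarrow> real) topology)"
  unfolding euclidean_product_topology[symmetric]
  by (simp add: Hausdorff_space_product_topology)

lemma compact_imp_closed_fun: "compact S \<Longrightarrow> closed (S :: ('i \<Rightarrow> real) set)"
  using compactin_imp_closedin[OF Hausdorff_space_fun] by simp

lemma continuous_stone_cech_coord: "continuous_on UNIV stone_cech_coord"
  unfolding continuous_on_open_vimage[OF open_UNIV] by (auto simp: open_stone_cech_def)

instance stone_cech :: (topological_space) t2_space
proof
  fix x y :: "'a stone_cech"
  assume "x \<noteq> y"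
  then have "stone_cech_coord x \<noteq> stone_cech_coord y"
    by (simp add: stone_cech_coord_inject)
  then obtain U V where "open U" "open V" "stone_cech_coord x \<in> U" "stone_cech_coord y \<in> V"
    "disjnt U V"
    using Hausdorff_space_fun unfolding Hausdorff_space_def
    by (metis UNIV_I open_openin topspace_euclidean)
  then show "\<exists>U V. open U \<and> open V \<and> x \<in> U \<and> y \<in> V \<and> U \<inter> V = {}"
    by (intro exI[of _ "stone_cech_coord -` U"] exI[of _ "stone_cech_coord -` V"])
       (auto simp: open_stone_cech_def disjnt_def)
qed

lemma continuous_stone_cech_embed: "continuous_on UNIV stone_cech_embed"
proof -
  have "continuous_on UNIV (\<lambda>(x::'a) (f :: 'a \<Rightarrow>\<^sub>C real). apply_bcontfun f x)"
    by (rule continuous_on_coordinatewise_then_product) simp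
  then have *: "open ((\<lambda>x f. apply_bcontfun f x) -` V :: 'a set)"
    if "open V" for V :: "(('a \<Rightarrow>\<^sub>C real) \<Rightarrow> real) set"
    using that by (simp add: open_vimage)
  have "open (stone_cech_embed -` U :: 'a set)" if U: "open U" for U
  proof -
    obtain V where V: "open V" "U = stone_cech_coord -` V"
      using U unfolding open_stone_cech_def by blast
    then have "stone_cech_embed -` U = (\<lambda>(x::'a) f. apply_bcontfun f x) -` V"
      by (simp add: vimage_def)
    then show ?thesis
      using *[OF V(1)] by simp
  qed
  then show ?thesis
    by (simp add: continuous_on_open_vimage)
qed

lemma closure_range_stone_cech_embed: "closure (range stone_cech_embed) = UNIV"
proof -
  define R where "R = range (\<lambda>(x::'a) (f :: 'a \<Rightarrow>\<^sub>C real). apply_bcontfun f x)"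
  have "z \<in> closure (range stone_cech_embed)" for z :: "'a stone_cech"
  proof (rule ccontr)
    define U where "U = - closure (range (stone_cech_embed :: 'a \<Rightarrow> _))"
    assume "z \<notin> closure (range stone_cech_embed)"
    then have "z \<in> U" by (simp add: U_def)
    have "open U" by (simp add: U_def open_Compl)
    then obtain V where V: "open V" "U = stone_cech_coord -` V"
      unfolding open_stone_cech_def by metis
    have "stone_cech_coord z \<in> closure R"
      unfolding R_def by (rule stone_cech_coord)
    moreover have "stone_cech_coord z \<in> V"
      using \<open>z \<in> U\<close> unfolding V by simp
    ultimately have "V \<inter> R \<noteq> {}"
      using open_Int_closure_eq_empty[OF V(1), of R] by blast
    then obtain x :: 'a where "stone_cech_coord (stone_cech_embed x) \<in> V"
      unfolding R_def stone_cech_coord_embed by blast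
    then have "stone_cech_embed x \<in> U"
      unfolding V by simp
    moreover have "stone_cech_embed x \<in> closure (range stone_cech_embed)"
      by (rule subsetD[OF closure_subset rangeI])
    ultimately show False
      unfolding U_def by blast
  qed
  then show ?thesis by blast
qed

lemma compact_stone_cech: "compact (UNIV :: 'a::topological_space stone_cech set)"
proof -
  define P where "P = PiE UNIV (\<lambda>f :: 'a \<Rightarrow>\<^sub>C real. cball (0::real) (norm f))"
  define R where "R = range (\<lambda>(x::'a) (f :: 'a \<Rightarrow>\<^sub>C real). apply_bcontfun f x)"
  have "compactin (product_topology (\<lambda>_. euclidean) UNIV) P"
    unfolding P_def compactin_PiE by simp
  then have P: "compact P"
    by (simp add: euclidean_product_topology)
  have "closed P"
    using P by (rule compact_imp_closed_fun)
  moreover have "R \<subseteq> P"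
    using norm_bounded[where 'b = real] by (auto simp: R_def P_def)
  ultimately have "closure R \<subseteq> P"
    by (simp add: closure_minimal)
  then have R: "compact (closure R)"
    using P by (metis closed_closure compact_Int_closed inf.absorb_iff2)
  have coord: "range (stone_cech_coord :: 'a stone_cech \<Rightarrow> _) = closure R"
    unfolding R_def by (rule type_definition.Rep_range[OF type_definition_stone_cech])
  show ?thesis
  proof (rule compactI)
    fix C :: "'a stone_cech set set"
    assume C: "\<forall>U\<in>C. open U" "UNIV \<subseteq> \<Union>C"
    then obtain V where V: "\<And>U. U \<in> C \<Longrightarrow> open (V U) \<and> U = stone_cech_coord -` V U"
      unfolding open_stone_cech_def by metis
    have "stone_cech_coord z \<in> (\<Union>U\<in>C. V U)" for z
    proof -
      obtain U where "U \<in> C" "z \<in> U" using C(2) by blast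
      then show ?thesis using V[of U] by blast
    qed
    then have "closure R \<subseteq> (\<Union>U\<in>C. V U)"
      unfolding coord[symmetric] by (rule image_subsetI)
    then obtain D where D: "D \<subseteq> C" "finite D" "closure R \<subseteq> (\<Union>U\<in>D. V U)"
      using compactE_image[OF R, of C V] V by metis
    have "z \<in> \<Union>D" for z
    proof -
      have "stone_cech_coord z \<in> closure R"
        unfolding coord[symmetric] by (rule rangeI)
      then obtain U where "U \<in> D" "stone_cech_coord z \<in> V U"
        using D(3) by blast
      moreover from this have "U = stone_cech_coord -` V U"
        using D(1) V by blast
      ultimately show ?thesis by blast
    qed
    then show "\<exists>D\<subseteq>C. finite D \<and> UNIV \<subseteq> \<Union>D"
      using D by blast
  qed
qed

lemma continuous_on_stone_cech_in_bcontfun: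
  fixes f :: "'a::topological_space stone_cech \<Rightarrow> 'b::metric_space"
  shows "f \<in> bcontfun \<longleftrightarrow> continuous_on UNIV f"
  using compact_stone_cech
  by (auto simp: bcontfun_def intro: compact_imp_bounded compact_continuous_image)

text \<open>The universal property.\<close>

lemma stone_cech_extension:
  fixes g :: "'a::topological_space \<Rightarrow> 'k::t2_space"
  assumes K: "compact (UNIV :: 'k set)" and g: "continuous_on UNIV g"
  shows "\<exists>!G. continuous_on UNIV G \<and> (\<forall>x. G (stone_cech_embed x) = g x)"
proof
  define E where "E = (\<lambda>(y::'k) (h :: 'k \<Rightarrow>\<^sub>C real). apply_bcontfun h y)"
  define \<Phi> where "\<Phi> = (\<lambda>v (h :: 'k \<Rightarrow>\<^sub>C real). v (Bcontfun (\<lambda>x. h (g x))) :: real)"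
  let ?H = "\<lambda>z. inv E (\<Phi> (stone_cech_coord z))"
  have E: "continuous_on UNIV E"
    unfolding E_def by (rule continuous_on_coordinatewise_then_product) simp
  have \<Phi>: "continuous_on UNIV \<Phi>"
    unfolding \<Phi>_def
    by (intro continuous_on_coordinatewise_then_product continuous_on_product_coordinates)
  have "inj E"
  proof (rule injI, rule ccontr)
    fix y z assume eq: "E y = E z" and "y \<noteq> z"
    have "Hausdorff_space (euclidean :: 'k topology)"
      unfolding Hausdorff_space_def disjnt_def by (metis hausdorff open_openin)
    then have "normal_space (euclidean :: 'k topology)"
      using K by (intro compact_Hausdorff_or_regular_imp_normal_space) (auto simp: compact_space_def)
    then obtain h where h: "continuous_map euclidean (top_of_set {0..1::real}) h"
      "h ` {y} \<subseteq> {0}" "h ` {z} \<subseteq> {1}"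
      using Urysohn_lemma[of "euclidean :: 'k topology" "{y}" "{z}" 0 1] \<open>y \<noteq> z\<close>
      by (auto simp: disjnt_def)
    then have "h \<in> bcontfun"
      by (intro bcontfun_normI[of _ 1]) (auto simp: continuous_map_in_subtopology Pi_iff abs_le_iff 
          intro: order_trans[of _ 0])
    then have "E y (Bcontfun h) \<noteq> E z (Bcontfun h)"
      using h by (auto simp: E_def Bcontfun_inverse)
    with eq show False by simp
  qed
  have hg: "(\<lambda>x. apply_bcontfun h (g x)) \<in> bcontfun" for h :: "'k \<Rightarrow>\<^sub>C real"
    using norm_bounded[of h] g
    by (intro bcontfun_normI[of _ "norm h"]) (auto intro: continuous_on_compose2[OF _ g])
  then have comm: "\<Phi> (stone_cech_coord (stone_cech_embed x)) = E (g x)" for x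
    by (simp add: \<Phi>_def E_def Bcontfun_inverse)
  have "closed (range E)"
    by (intro compact_imp_closed_fun compact_continuous_image E K)
  then have "closed (\<Phi> -` range E)"
    using \<Phi> by (simp add: continuous_on_closed_vimage)
  moreover have "range (\<lambda>(x::'a) (f :: 'a \<Rightarrow>\<^sub>C real). apply_bcontfun f x) \<subseteq> \<Phi> -` range E"
    using comm by auto
  ultimately have "\<Phi> (stone_cech_coord z) \<in> range E" for z
    using stone_cech_coord[of z] closure_minimal by blast
  moreover have "continuous_on (range E) (inv E)"
    using continuous_inverse_map[of euclidean euclidean E "inv E" "range E"]
      Hausdorff_space_fun E K \<open>inj E\<close>
    by (simp add: compact_space_def)
  ultimately show "continuous_on UNIV ?H \<and> (\<forall>x. ?H (stone_cech_embed x) = g x)"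
    using \<open>inj E\<close> unfolding comm
    by (auto intro!: continuous_on_compose2[of "range E" "inv E"] continuous_on_compose2[OF \<Phi>]
        continuous_stone_cech_coord)
  then have H: "continuous_on UNIV ?H"
    and Hg: "?H (stone_cech_embed x) = g x" for x
    by blast+
  fix G
  assume G: "continuous_on UNIV G \<and> (\<forall>x. G (stone_cech_embed x) = g x)"
  show "G = ?H"
  proof (rule ccontr)
    assume "G \<noteq> ?H"
    then obtain z where "G z \<noteq> ?H z" by blast
    then obtain U V where UV: "open U" "open V" "G z \<in> U" "?H z \<in> V" "U \<inter> V = {}"
      by (metis hausdorff)
    then have "open (G -` U \<inter> ?H -` V)"
      using G H by (intro open_Int open_vimage) auto
    moreover have "z \<in> (G -` U \<inter> ?H -` V) \<inter> closure (range stone_cech_embed)"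
      using UV by (simp add: closure_range_stone_cech_embed)
    ultimately have "(G -` U \<inter> ?H -` V) \<inter> range stone_cech_embed \<noteq> {}"
      using open_Int_closure_eq_empty by blast
    then obtain x where "G (stone_cech_embed x) \<in> U" "?H (stone_cech_embed x) \<in> V"
      by blast
    then show False
      using G Hg UV by auto
  qed
qed

text \<open>The embedding of \<open>nat\<close> is injective with discrete open image.\<close>

lemma inj_stone_cech_embed_nat: "inj (stone_cech_embed :: nat \<Rightarrow> nat stone_cech)"
proof (rule injI)
  fix m n :: nat
  assume eq: "stone_cech_embed m = stone_cech_embed n"
  have f: "indicator {n} \<in> (bcontfun :: (nat \<Rightarrow> real) set)"
    by (rule bcontfun_normI[of _ 1]) (auto simp: indicator_def)
  from eq have "stone_cech_coord (stone_cech_embed m) (Bcontfun (indicator {n})) =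
      stone_cech_coord (stone_cech_embed n) (Bcontfun (indicator {n}))"
    by simp
  then show "m = n"
    using f by (simp add: Bcontfun_inverse indicator_def split: if_splits)
qed

lemma open_stone_cech_embed_nat: "open {stone_cech_embed (n::nat)}"
proof -
  define f :: "nat \<Rightarrow>\<^sub>C real" where "f = Bcontfun (indicator {n})"
  have f: "apply_bcontfun f = indicator {n}"
    unfolding f_def by (rule Bcontfun_inverse, rule bcontfun_normI[of _ 1]) (auto simp: indicator_def)
  define U where "U = {z. stone_cech_coord z f > 0}"
  have "continuous_on UNIV (\<lambda>z. stone_cech_coord z f)"
    by (rule continuous_on_compose2[OF continuous_on_product_coordinates continuous_stone_cech_coord])
       simp
  then have "open U"
    unfolding U_def by (intro open_Collect_less) auto
  then have op: "open (U - {stone_cech_embed n})"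
    by (simp add: open_Diff)
  have "(U - {stone_cech_embed n}) \<inter> range stone_cech_embed = {}"
    by (auto simp: U_def f indicator_def split: if_splits)
  then have "U - {stone_cech_embed n} = {}"
    using open_Int_closure_eq_empty[OF op, of "range stone_cech_embed"]
    by (simp add: closure_range_stone_cech_embed)
  moreover have "stone_cech_embed n \<in> U"
    by (simp add: U_def f)
  ultimately have "U = {stone_cech_embed n}"
    by blast
  with \<open>open U\<close> show ?thesis by simp
qed

end

theory Submission
  imports Defs
begin

text \<open>
  The obstruction is that an element of \<open>C(K, B(H))\<close> with \<open>K\<close> compact has norm compact range, while
  the entries of a bounded sequence of operators are arbitrary. A Jordan isomorphism \<open>\<phi>\<close> from
  \<open>\<ell>\<^sub>\<infinity>(B(H))\<close> onto \<open>C(K, B(H))\<close> acts on the individual entries: the identity \<open>e\<^sub>n\<close> of the \<open>n\<close>-th summand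
  is a central idempotent, hence so is \<open>\<phi>(e\<^sub>n)\<close> (\<open>jordan_homomorphism_central_idempotent\<close>), and as \<open>B(H)\<close>
  has trivial centre, \<open>\<phi>(e\<^sub>n)\<close> takes only the values \<open>0\<close> and \<open>1\<close> (\<open>central_idempotent_bop\<close>). Wherever it is
  \<open>1\<close>, the value of \<open>\<phi>(x)\<close> depends on the \<open>n\<close>-th entry of \<open>x\<close> alone.

  The map \<open>\<phi>\<close> may distort each entry in its own way (by unitary conjugations, say), so a fixed sequence
  of operators could be sent to a constant function. The sequence is therefore adapted to
  \<open>\<phi>\<close>. Let \<open>q\<^sub>0, q\<^sub>1, \<dots>\<close> be the projections onto the lines of an orthonormal sequence, and let \<open>t\<^sub>n\<close> be a
  point of \<open>K\<close> at which the image of \<open>q\<^sub>0\<close>, put in position \<open>n\<close>, does not vanish. For each \<open>n\<close>, the images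
  of all \<open>q\<^sub>i\<close> in position \<open>n\<close>, evaluated at \<open>t\<^sub>n\<close>, are nonzero pairwise orthogonal idempotents, so
  they are at distance at least \<open>1\<close> from each other (\<open>dist_orthogonal_idempotents_ge_1\<close>). By the pigeonhole
  principle one can pick an index \<open>c\<^sub>n\<close> for each \<open>n\<close> such that the images of \<open>q\<close> with index \<open>c\<^sub>n\<close> are
  \<open>1/2\<close>-separated as \<open>n\<close> varies (\<open>exists_separated_selection\<close>). These images are the values
  at the points \<open>t\<^sub>n\<close> of \<open>\<phi>(x)\<close>, where \<open>x\<close> is the sequence of the selected projections. An infinite
  separated set in the compact range of \<open>\<phi>(x)\<close> is impossible.

  No continuity of \<open>\<phi>\<close> enters: the lower bounds on distances come from algebraic relations. The other
  direction of the corollary is the same statement for the inverse map.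
\<close>

section \<open>Jordan homomorphisms\<close>

lemma jordan_homomorphism_linear:
  assumes "jordan_homomorphism \<phi>"
  shows "\<phi> (A + B) = \<phi> A + \<phi> B" "\<phi> (A - B) = \<phi> A - \<phi> B" "\<phi> 0 = 0"
    "\<phi> (c *\<^sub>C A) = c *\<^sub>C \<phi> A"
proof -
  interpret linear_map: Vector_Spaces.linear scaleC scaleC \<phi>
    using assms by (simp add: jordan_homomorphism_def)
  show "\<phi> (A + B) = \<phi> A + \<phi> B" "\<phi> (A - B) = \<phi> A - \<phi> B" "\<phi> 0 = 0"
    "\<phi> (c *\<^sub>C A) = c *\<^sub>C \<phi> A"
    by (rule linear_map.add linear_map.diff linear_map.zero linear_map.scale)+
qed

lemma jordan_homomorphism_square:
  "jordan_homomorphism \<phi> \<Longrightarrow> \<phi> (A * A) = \<phi> A * \<phi> A"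
  by (simp add: jordan_homomorphism_def)

text \<open>Squares determine the anticommutator by polarization.\<close>

lemma jordan_homomorphism_anticommutator:
  assumes "jordan_homomorphism \<phi>"
  shows "\<phi> (A * B + B * A) = \<phi> A * \<phi> B + \<phi> B * \<phi> A"
proof -
  have "A * B + B * A = (A + B) * (A + B) - A * A - B * B"
    by (simp add: algebra_simps)
  then have "\<phi> (A * B + B * A) = (\<phi> A + \<phi> B) * (\<phi> A + \<phi> B) - \<phi> A * \<phi> A - \<phi> B * \<phi> B"
    using assms by (simp only: jordan_homomorphism_linear jordan_homomorphism_square)
  then show ?thesis
    by (simp add: algebra_simps)
qed

lemma double_eq_imp_eq:
  fixes x y :: "'a::real_vector"
  assumes "x + x = y + y"
  shows "x = y"
proof -
  have "2 *\<^sub>R x = 2 *\<^sub>R y"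
    using assms by (simp add: scaleR_2)
  then show ?thesis
    by simp
qed

text \<open>
  With \<open>A \<circ> B = AB + BA\<close>, the triple product is Jordan expressible:
  \<open>2ABA = A \<circ> (A \<circ> B) - A\<^sup>2 \<circ> B\<close>.
\<close>

lemma jordan_homomorphism_triple:
  assumes \<phi>: "jordan_homomorphism \<phi>"
  shows "\<phi> (A * B * A) = \<phi> A * \<phi> B * \<phi> A"
proof (rule double_eq_imp_eq)
  let ?C = "A * B + B * A"
  have "A * B * A + A * B * A = (A * ?C + ?C * A) - (A * A * B + B * (A * A))"
    by (simp add: algebra_simps)
  then have "\<phi> (A * B * A) + \<phi> (A * B * A) =
      \<phi> (A * ?C + ?C * A) - \<phi> (A * A * B + B * (A * A))"
    by (simp only: flip: jordan_homomorphism_linear(1,2)[OF \<phi>])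
  also have "\<dots> = (\<phi> A * \<phi> ?C + \<phi> ?C * \<phi> A) - (\<phi> A * \<phi> A * \<phi> B + \<phi> B * (\<phi> A * \<phi> A))"
    by (simp only: jordan_homomorphism_anticommutator[OF \<phi>] jordan_homomorphism_square[OF \<phi>])
  also have "\<dots> = \<phi> A * \<phi> B * \<phi> A + \<phi> A * \<phi> B * \<phi> A"
    by (simp add: jordan_homomorphism_anticommutator[OF \<phi>] algebra_simps)
  finally show "\<phi> (A * B * A) + \<phi> (A * B * A) = \<phi> A * \<phi> B * \<phi> A + \<phi> A * \<phi> B * \<phi> A" .
qed

lemma jordan_homomorphism_inv:
  assumes "bij \<phi>" and \<phi>: "jordan_homomorphism \<phi>"
  shows "jordan_homomorphism (inv \<phi>)"
  unfolding jordan_homomorphism_def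
proof (intro conjI allI)
  have right: "\<phi> (inv \<phi> y) = y" for y
    using \<open>bij \<phi>\<close> by (simp add: bij_is_surj surj_f_inv_f)
  have left: "inv \<phi> (\<phi> x) = x" for x
    using \<open>bij \<phi>\<close> by (simp add: bij_is_inj)
  show "Vector_Spaces.linear scaleC scaleC (inv \<phi>)"
  proof unfold_locales
    show "inv \<phi> (x + y) = inv \<phi> x + inv \<phi> y" for x y
      using jordan_homomorphism_linear(1)[OF \<phi>, of "inv \<phi> x" "inv \<phi> y"]
      by (metis right left)
    show "inv \<phi> (c *\<^sub>C x) = c *\<^sub>C inv \<phi> x" for c x
      using jordan_homomorphism_linear(4)[OF \<phi>, of c "inv \<phi> x"]
      by (metis right left)
  qed
  show "inv \<phi> A * inv \<phi> A = inv \<phi> (A * A)" for A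
    using jordan_homomorphism_square[OF \<phi>, of "inv \<phi> A"] by (metis right left)
qed

text \<open>
  For idempotents, orthogonality is the single Jordan relation \<open>PQ + QP = 0\<close>: multiplying it by \<open>P\<close> on
  either side shows that \<open>P\<close> and \<open>Q\<close> commute, so both products vanish.
\<close>

lemma jordan_homomorphism_orthogonal_idempotents:
  assumes \<phi>: "jordan_homomorphism \<phi>"
    and "P * P = P" "Q * Q = Q" "P * Q = 0" "Q * P = 0"
  shows "\<phi> P * \<phi> Q = 0"
proof (rule double_eq_imp_eq)
  let ?P = "\<phi> P" and ?Q = "\<phi> Q"
  have P: "?P * ?P = ?P"
    using jordan_homomorphism_square[OF \<phi>, of P] assms by simp
  have "?P * ?Q + ?Q * ?P = 0"
    using jordan_homomorphism_anticommutator[OF \<phi>, of P Q] assms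
    by (simp add: jordan_homomorphism_linear)
  then have anti: "?P * ?Q = - (?Q * ?P)"
    by (simp add: eq_neg_iff_add_eq_0)
  have "?P * ?Q = ?P * (?P * ?Q)"
    by (simp add: P flip: mult.assoc)
  also have "\<dots> = - (?P * ?Q * ?P)"
    by (subst anti) (simp add: mult.assoc)
  also have "\<dots> = ?Q * ?P"
    by (subst anti) (simp add: mult.assoc P)
  finally have "?P * ?Q = ?Q * ?P" .
  with \<open>?P * ?Q + ?Q * ?P = 0\<close> show "?P * ?Q + ?P * ?Q = 0 + 0"
    by simp
qed

text \<open>
  An idempotent \<open>e\<close> commutes with \<open>A\<close> iff \<open>eA + Ae = 2eAe\<close>, a relation between anticommutator and triple
  product that \<open>\<phi>\<close> respects. So for central \<open>e\<close> and surjective \<open>\<phi>\<close> the image of \<open>e\<close> is central again, and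
  multiplication by \<open>e\<close>, which is \<open>A \<mapsto> eAe\<close>, is carried to multiplication by \<open>\<phi> e\<close>.
\<close>

lemma jordan_homomorphism_central_idempotent:
  assumes \<phi>: "jordan_homomorphism \<phi>"
    and e: "e * e = e" and central: "e * A = A * e"
  shows "\<phi> (e * A) = \<phi> e * \<phi> A" "\<phi> e * \<phi> A = \<phi> A * \<phi> e"
proof -
  let ?e = "\<phi> e" and ?A = "\<phi> A"
  have ee: "?e * ?e = ?e"
    using jordan_homomorphism_square[OF \<phi>, of e] e by simp
  have eA: "e * A = e * A * e"
    by (metis e central mult.assoc)
  then have triple: "\<phi> (e * A) = ?e * ?A * ?e"
    by (metis jordan_homomorphism_triple[OF \<phi>])
  have "?e * ?A + ?A * ?e = \<phi> (e * A) + \<phi> (e * A)"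
    by (metis jordan_homomorphism_anticommutator[OF \<phi>] jordan_homomorphism_linear(1)[OF \<phi>] central)
  then have sum: "?e * ?A + ?A * ?e = ?e * ?A * ?e + ?e * ?A * ?e"
    by (simp add: triple)
  have "?e * (?e * ?A + ?A * ?e) = ?e * ?A + ?e * ?A * ?e"
    using ee by (metis distrib_left mult.assoc)
  moreover have "?e * (?e * ?A * ?e + ?e * ?A * ?e) = ?e * ?A * ?e + ?e * ?A * ?e"
    using ee by (metis distrib_left mult.assoc)
  ultimately have left: "?e * ?A = ?e * ?A * ?e"
    using sum by simp
  with sum have "?A * ?e = ?e * ?A * ?e"
    by simp
  with left triple show "\<phi> (e * A) = ?e * ?A" "?e * ?A = ?A * ?e"
    by simp_all
qed

text \<open>
  Since \<open>P = P(P - Q)\<close>, the norm of \<open>P\<close> cancels. The bound is thus uniform over idempotents of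
  arbitrarily large norm, which is what replaces continuity of the Jordan homomorphism.
\<close>

lemma dist_orthogonal_idempotents_ge_1:
  fixes P Q :: "'a::real_normed_algebra"
  assumes "P * P = P" "P \<noteq> 0" "P * Q = 0"
  shows "1 \<le> dist P Q"
proof -
  have "norm P = norm (P * (P - Q))"
    using assms by (simp add: algebra_simps)
  also have "\<dots> \<le> norm P * dist P Q"
    by (simp add: norm_mult_ineq dist_norm)
  finally show ?thesis
    using \<open>P \<noteq> 0\<close> by simp
qed

section \<open>Rank-one operators and orthonormal sequences\<close>

lemma cinner_simps:
  fixes x y z :: "'a::complex_inner"
  shows "cinner (x + y) z = cinner x z + cinner y z"
    "cinner (x - y) z = cinner x z - cinner y z"
    "cinner (a *\<^sub>C x) z = a * cinner x z"
    "cinner 0 z = 0"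
    "cinner (sum f S) z = (\<Sum>i\<in>S. cinner (f i) z)"
proof -
  show add: "cinner (x + y) z = cinner x z + cinner y z" for x y :: 'a
    by (rule cinner_add_left)
  from add[of 0 0] show zero: "cinner 0 z = 0"
    by simp
  from add[of "x - y" y] show "cinner (x - y) z = cinner x z - cinner y z"
    by simp
  show "cinner (a *\<^sub>C x) z = a * cinner x z"
    by (rule cinner_scaleC_left)
  show "cinner (sum f S) z = (\<Sum>i\<in>S. cinner (f i) z)"
    by (induction S rule: infinite_finite_induct) (simp_all add: add zero)
qed

lemma cinner_zero_right [simp]: "cinner x 0 = 0"
  by (metis cinner_commute cinner_simps(4) complex_cnj_zero)

lemma cinner_Cauchy_Schwarz:
  fixes x y :: "'a::complex_inner"
  shows "cmod (cinner x y) \<le> norm x * norm y"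
proof (cases "y = 0")
  case False
  define c where "c = cinner x y"
  \<comment> \<open>the component of \<open>x\<close> orthogonal to \<open>y\<close>, scaled by \<open>\<parallel>y\<parallel>\<^sup>2\<close> to avoid division\<close>
  define z where "z = cinner y y *\<^sub>C x - c *\<^sub>C y"
  have orth: "cinner z y = 0"
    by (simp add: z_def c_def cinner_simps)
  have "cinner z z = cinner y y * cinner x z - c * cinner y z"
    by (subst (1) z_def) (simp add: cinner_simps)
  also have "cinner y z = 0"
    using orth by (metis cinner_commute complex_cnj_zero)
  also have "cinner x z = cnj (cinner y y * cinner x x - c * cinner y x)"
    by (subst cinner_commute) (simp add: z_def cinner_simps)
  also have "c * cinner y x = complex_of_real ((cmod c)\<^sup>2)"
    by (metis c_def cinner_commute complex_norm_square)
  finally have "complex_of_real ((norm z)\<^sup>2) =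
      complex_of_real ((norm y)\<^sup>2 * ((norm y)\<^sup>2 * (norm x)\<^sup>2 - (cmod c)\<^sup>2))"
    by (simp add: cinner_eq_norm)
  then have "(norm z)\<^sup>2 = (norm y)\<^sup>2 * ((norm y)\<^sup>2 * (norm x)\<^sup>2 - (cmod c)\<^sup>2)"
    using of_real_eq_iff by blast
  then have "0 \<le> (norm y)\<^sup>2 * ((norm y)\<^sup>2 * (norm x)\<^sup>2 - (cmod c)\<^sup>2)"
    by (metis zero_le_power2)
  with False have "(cmod c)\<^sup>2 \<le> (norm x * norm y)\<^sup>2"
    by (simp add: zero_le_mult_iff power_mult_distrib mult.commute)
  then show ?thesis
    by (simp add: c_def power2_le_iff_abs_le)
qed simp

lemma bounded_linear_rank_one: "bounded_linear (\<lambda>v. cinner v y *\<^sub>C x)"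
  for x y :: "'a::complex_inner"
proof (rule bounded_linear_intro)
  show "norm (cinner v y *\<^sub>C x) \<le> norm v * (norm y * norm x)" for v
    using mult_right_mono[OF cinner_Cauchy_Schwarz[of v y] norm_ge_zero[of x]]
    by (simp add: norm_scaleC mult.assoc)
qed (simp_all add: scaleR_scaleC cinner_simps scaleC_add_left scaleC_scaleC)

lift_definition rank_one :: "'a::complex_inner \<Rightarrow> 'a \<Rightarrow> 'a bop"
  is "\<lambda>x y. Blinfun (\<lambda>v. cinner v y *\<^sub>C x)"
  by (simp add: bounded_linear_Blinfun_apply bounded_linear_rank_one cinner_simps scaleC_scaleC)

lemma rank_one_apply [simp]: "bop_apply (rank_one x y) v = cinner v y *\<^sub>C x"
  by transfer (simp add: bounded_linear_Blinfun_apply bounded_linear_rank_one)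

lemma rank_one_mult: "rank_one x y * rank_one x' y' = cinner x' y *\<^sub>C rank_one x y'"
  by (rule bop_eqI) (simp add: cinner_simps scaleC_scaleC mult.commute)

lift_definition id_bop :: "'a::complex_normed_vector bop" is id_blinfun
  by simp

lemma id_bop_apply [simp]: "bop_apply id_bop v = v"
  by transfer simp

lemma id_bop_mult [simp]: "id_bop * T = T" "T * id_bop = T"
  by (rule bop_eqI, simp)+

text \<open>
  A vector \<open>v \<noteq> 0\<close> in the range of \<open>P\<close> can be mapped to a nonzero multiple of any \<open>w\<close> by a rank-one
  operator. As \<open>P\<close> commutes with that operator, it fixes \<open>w\<close> as well.
\<close>

lemma central_idempotent_bop:
  fixes P :: "'a::complex_inner bop"
  assumes idem: "P * P = P" and central: "\<And>T. P * T = T * P"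
  shows "P = 0 \<or> P = id_bop"
proof (cases "P = 0")
  case False
  then obtain u where u: "bop_apply P u \<noteq> 0"
    by (metis bop_apply_simps(1) bop_eqI)
  define v where "v = bop_apply P u"
  have v: "bop_apply P v = v" "cinner v v \<noteq> 0"
    using u by (simp_all add: v_def cinner_eq_norm idem flip: bop_apply_simps(6))
  have "bop_apply P w = w" for w
  proof -
    have "cinner v v *\<^sub>C bop_apply P w = bop_apply (P * rank_one w v) v"
      by simp
    also have "\<dots> = cinner v v *\<^sub>C w"
      unfolding central using v by simp
    finally show ?thesis
      using v by simp
  qed
  then show ?thesis
    by (simp add: bop_eqI)
qed simp

text \<open>One Gram-Schmidt step, applied to a vector outside the span.\<close>

lemma exists_unit_orthogonal:
  fixes S :: "'a::complex_inner set"
  assumes fin: "finite S"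
    and orthonormal: "\<And>x y. x \<in> S \<Longrightarrow> y \<in> S \<Longrightarrow> cinner x y = of_bool (x = y)"
    and not_spanning: "cspan S \<noteq> UNIV"
  shows "\<exists>x. norm x = 1 \<and> (\<forall>y\<in>S. cinner x y = 0)"
proof -
  obtain v where v: "v \<notin> cspan S"
    using not_spanning by blast
  define w where "w = v - (\<Sum>x\<in>S. cinner v x *\<^sub>C x)"
  have "(\<Sum>x\<in>S. cinner v x *\<^sub>C x) \<in> cspan S"
    by (intro complex_vector.span_sum complex_vector.span_scale complex_vector.span_base)
  with v have "w \<noteq> 0"
    by (auto simp: w_def)
  have "cinner w y = 0" if "y \<in> S" for y
  proof -
    have "cinner w y = cinner v y - (\<Sum>x\<in>S. cinner v x * cinner x y)"
      by (simp add: w_def cinner_simps)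
    also have "(\<Sum>x\<in>S. cinner v x * cinner x y) = (\<Sum>x\<in>S. if x = y then cinner v y else 0)"
      using that by (intro sum.cong) (auto simp: orthonormal)
    also have "\<dots> = cinner v y"
      using fin that by simp
    finally show ?thesis
      by simp
  qed
  then have "\<forall>y\<in>S. cinner (complex_of_real (inverse (norm w)) *\<^sub>C w) y = 0"
    by (simp add: cinner_simps)
  moreover have "norm (complex_of_real (inverse (norm w)) *\<^sub>C w) = 1"
    using \<open>w \<noteq> 0\<close> by (simp add: norm_scaleC norm_inverse)
  ultimately show ?thesis
    by blast
qed

lemma exists_orthonormal_sequence:
  assumes infinite_dimensional: "\<And>B :: 'a::complex_inner set. finite B \<Longrightarrow> cspan B \<noteq> UNIV"
  shows "\<exists>u :: nat \<Rightarrow> 'a. \<forall>i j. cinner (u i) (u j) = of_bool (i = j)"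
proof -
  let ?P = "\<lambda>(u :: nat \<Rightarrow> 'a) n x. norm x = 1 \<and> (\<forall>m<n. cinner x (u m) = 0)"
  have "\<exists>u. \<forall>n. ?P u n (u n)"
  proof (rule dependent_wf_choice[OF wf_less])
    fix n u
    assume "\<And>m. (m, n) \<in> {(x, y). x < y} \<Longrightarrow> ?P u m (u m)"
    then have u: "?P u m (u m)" if "m < n" for m
      using that by simp
    have one: "cinner (u m) (u m) = 1" if "m < n" for m
      using u[OF that] by (simp add: cinner_eq_norm)
    have zero: "cinner (u k) (u m) = 0" if "k < n" "m < n" "u k \<noteq> u m" for k m
    proof (cases k m rule: linorder_cases)
      case less
      with u[OF \<open>m < n\<close>] show ?thesis
        by (metis cinner_commute complex_cnj_zero)
    qed (use u that in auto)
    have "\<exists>x. norm x = 1 \<and> (\<forall>y\<in>u ` {..<n}. cinner x y = 0)"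
      by (rule exists_unit_orthogonal) (auto simp: one zero infinite_dimensional)
    then show "\<exists>x. ?P u n x"
      by auto
  qed auto
  then obtain u where u: "\<And>n. ?P u n (u n)"
    by blast
  have "cinner (u i) (u j) = of_bool (i = j)" for i j
  proof (cases i j rule: linorder_cases)
    case less
    with u[of j] show ?thesis
      by (metis cinner_commute complex_cnj_zero less_irrefl of_bool_eq(1))
  qed (use u in \<open>auto simp: cinner_eq_norm\<close>)
  then show ?thesis
    by blast
qed

section \<open>Choosing separated entries from an infinite array\<close>

text \<open>
  Once \<open>n\<close> points have been selected, row \<open>n\<close> still contains an admissible one: its entries are so far
  apart that each earlier point is closer than \<open>1/2\<close> to at most one of them, and \<open>n + 1\<close> entries cannot
  all be excluded by \<open>n\<close> points.
\<close>

lemma exists_separated_selection: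
  fixes f :: "nat \<Rightarrow> nat \<Rightarrow> 'a::metric_space"
  assumes rows: "\<And>n i j. i \<noteq> j \<Longrightarrow> 1 \<le> dist (f n i) (f n j)"
  shows "\<exists>c. \<forall>m n. m \<noteq> n \<longrightarrow> 1 / 2 \<le> dist (f m (c m)) (f n (c n))"
proof -
  let ?P = "\<lambda>c n i. \<forall>m<n. 1 / 2 \<le> dist (f m (c m)) (f n i)"
  have "\<exists>c. \<forall>n. ?P c n (c n)"
  proof (rule dependent_wf_choice[OF wf_less])
    fix n and c :: "nat \<Rightarrow> nat"
    show "\<exists>i. ?P c n i"
    proof (rule ccontr)
      assume "\<nexists>i. ?P c n i"
      then obtain g where g: "\<And>i. g i < n" "\<And>i. dist (f (g i) (c (g i))) (f n i) < 1 / 2"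
        by (metis not_le)
      have "\<not> inj_on g {..n}"
        using card_inj_on_le[of g "{..n}" "{..<n}"] g(1) by auto
      then obtain i j where "i \<noteq> j" "g i = g j"
        by (auto simp: inj_on_def)
      then have "dist (f n i) (f n j) < 1"
        using g(2)[of i] g(2)[of j] dist_triangle_half_r by fastforce
      with rows[OF \<open>i \<noteq> j\<close>, of n] show False
        by simp
    qed
  qed auto
  then obtain c where "\<And>n. ?P c n (c n)"
    by blast
  then show ?thesis
    by (metis dist_commute linorder_neqE_nat)
qed

lemma compact_no_separated_sequence:
  fixes y :: "nat \<Rightarrow> 'a::metric_space"
  assumes "compact K" and "\<And>n. y n \<in> K"
    and "0 < \<epsilon>" and sep: "\<And>m n. m \<noteq> n \<Longrightarrow> \<epsilon> \<le> dist (y m) (y n)"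
  shows False
proof -
  have "seq_compact K"
    using assms(1) by (rule compact_imp_seq_compact)
  then obtain l r where r: "strict_mono (r :: nat \<Rightarrow> nat)" "(y \<circ> r) \<longlonglongrightarrow> l"
    using assms(2) by (metis seq_compactE)
  then have "Cauchy (y \<circ> r)"
    using LIMSEQ_imp_Cauchy by blast
  then obtain N where "\<And>m n. N \<le> m \<Longrightarrow> N \<le> n \<Longrightarrow> dist (y (r m)) (y (r n)) < \<epsilon>"
    using \<open>0 < \<epsilon>\<close> by (metis metric_CauchyD comp_apply)
  then have "dist (y (r N)) (y (r (Suc N))) < \<epsilon>"
    by simp
  moreover have "r N \<noteq> r (Suc N)"
    using r(1) by (metis strict_mono_eq n_not_Suc_n)
  ultimately show False
    using sep by fastforce
qed

section \<open>Sequences of operators and compact spaces\<close>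

lift_definition single :: "nat \<Rightarrow> 'b \<Rightarrow> 'b::real_normed_vector ell_infty"
  is "\<lambda>n b k. if k = n then b else 0"
proof -
  fix n :: nat and b :: 'b
  show "(\<lambda>k. if k = n then b else 0) \<in> bcontfun"
    by (rule bcontfun_normI[of _ "norm b"]) auto
qed

declare single.rep_eq [simp]

text \<open>
  The property of \<open>\<beta>\<nat>\<close> that excludes an isomorphism is its compactness: a function with a compact
  range cannot take the \<open>1/2\<close>-separated values that a suitable bounded sequence forces upon its image.
\<close>

theorem no_bijective_jordan_homomorphism_into_compact:
  fixes \<phi> :: "'h::complex_inner bop ell_infty \<Rightarrow> ('k::topological_space \<Rightarrow>\<^sub>C 'h bop)"
  assumes infinite_dimensional: "\<And>B :: 'h set. finite B \<Longrightarrow> cspan B \<noteq> UNIV"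
    and compact: "compact (UNIV :: 'k set)"
    and "bij \<phi>" and \<phi>: "jordan_homomorphism \<phi>"
  shows False
proof -
  obtain u :: "nat \<Rightarrow> 'h" where u: "\<And>i j. cinner (u i) (u j) = of_bool (i = j)"
    using exists_orthonormal_sequence[OF infinite_dimensional] by blast
  define q where "q i = rank_one (u i) (u i)" for i
  have q_mult: "q i * q j = (if i = j then q i else 0)" for i j
    by (simp add: q_def rank_one_mult u scaleC_one)
  have norm_u: "norm (u i) = 1" for i
    using u[of i i] by (simp add: cinner_eq_norm power2_eq_1_iff flip: of_real_power)
      (smt (verit) norm_ge_zero)
  have "q i \<noteq> 0" for i
  proof
    assume "q i = 0"
    then have "bop_apply (q i) (u i) = 0"
      by simp
    with u[of i i] show False
      by (simp add: q_def scaleC_one)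
  qed

  define e where "e n = single n (id_bop :: 'h bop)" for n
  have e_mult: "e n * x = single n (x n)" "x * e n = single n (x n)" for n x
    by (rule bcontfun_eqI; simp add: e_def)+
  have idem: "e n * e n = e n" for n
    by (simp add: e_mult) (simp add: e_def)
  have \<phi>_e: "\<phi> (e n * x) = \<phi> (e n) * \<phi> x" "\<phi> (e n) * \<phi> x = \<phi> x * \<phi> (e n)" for n x
    by (rule jordan_homomorphism_central_idempotent[OF \<phi> idem]; simp add: e_mult)+
  have e_values: "\<phi> (e n) t = 0 \<or> \<phi> (e n) t = id_bop" for n t
  proof (rule central_idempotent_bop)
    show "\<phi> (e n) t * \<phi> (e n) t = \<phi> (e n) t"
      using jordan_homomorphism_square[OF \<phi>, of "e n"] by (metis idem times_bcontfun.rep_eq)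
    fix T
    obtain x where "\<phi> x = const_bcontfun T"
      using \<open>bij \<phi>\<close> by (metis bij_pointE)
    then show "\<phi> (e n) t * T = T * \<phi> (e n) t"
      using \<phi>_e(2)[of n x] by (metis times_bcontfun.rep_eq const_bcontfun.rep_eq)
  qed

  \<comment> \<open>Injectivity of \<open>\<phi>\<close> provides the point \<open>t n\<close> at which the \<open>n\<close>-th entry is read off.\<close>
  have "\<exists>t. \<phi> (single n (q 0)) t \<noteq> 0" for n
  proof -
    have "single n (q 0) n \<noteq> 0"
      using \<open>q 0 \<noteq> 0\<close> by simp
    then have "single n (q 0) \<noteq> 0"
      by (metis zero_bcontfun.rep_eq)
    then have "\<phi> (single n (q 0)) \<noteq> 0"
      using \<open>bij \<phi>\<close> jordan_homomorphism_linear(3)[OF \<phi>] by (metis bij_pointE)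
    then show ?thesis
      by (metis bcontfun_eqI zero_bcontfun.rep_eq)
  qed
  then obtain t where t: "\<And>n. \<phi> (single n (q 0)) (t n) \<noteq> 0"
    by metis
  have e_t: "\<phi> (e n) (t n) = id_bop" for n
  proof -
    have "\<phi> (single n (q 0)) (t n) = \<phi> (e n) (t n) * \<phi> (single n (q 0)) (t n)"
      using \<phi>_e(1)[of n "single n (q 0)"] by (metis times_bcontfun.rep_eq e_mult(1) single.rep_eq)
    with t[of n] e_values[of n "t n"] show ?thesis
      by auto
  qed

  define f where "f n i = \<phi> (single n (q i)) (t n)" for n i
  have single_mult: "single n a * single n b = single n (a * b)" for n and a b :: "'h bop"
    by (rule bcontfun_eqI) simp
  have f_idem: "f n i * f n i = f n i" for n i
    using jordan_homomorphism_square[OF \<phi>, of "single n (q i)"]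
    by (metis f_def single_mult q_mult times_bcontfun.rep_eq)
  have f_orth: "f n i * f n j = 0" if "i \<noteq> j" for n i j
  proof -
    have zero: "single n 0 = (0 :: 'h bop ell_infty)"
      by (rule bcontfun_eqI) simp
    have "\<phi> (single n (q i)) * \<phi> (single n (q j)) = 0"
      by (rule jordan_homomorphism_orthogonal_idempotents[OF \<phi>])
         (use that in \<open>simp_all add: single_mult q_mult zero\<close>)
    then show ?thesis
      unfolding f_def by (metis times_bcontfun.rep_eq zero_bcontfun.rep_eq)
  qed
  have f_nonzero: "f n i \<noteq> 0" for n i
  proof (cases "i = 0")
    case False
    \<comment> \<open>\<open>s\<close> exchanges \<open>u 0\<close> and \<open>u i\<close>, so \<open>f n i = 0\<close> would force \<open>f n 0 = 0\<close>\<close>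
    define s where "s = rank_one (u i) (u 0) + rank_one (u 0) (u i)"
    have "s * q i * s = q 0"
      using False by (simp add: s_def q_def algebra_simps rank_one_mult u scaleC_one)
    then have "\<phi> (single n s) * \<phi> (single n (q i)) * \<phi> (single n s) = \<phi> (single n (q 0))"
      by (simp add: single_mult flip: jordan_homomorphism_triple[OF \<phi>])
    then have "f n 0 = \<phi> (single n s) (t n) * f n i * \<phi> (single n s) (t n)"
      unfolding f_def by (metis times_bcontfun.rep_eq)
    with t[of n] show ?thesis
      by (auto simp: f_def)
  qed (simp add: f_def t)

  have "1 \<le> dist (f n i) (f n j)" if "i \<noteq> j" for n i j
    using f_idem f_nonzero f_orth[OF that] by (rule dist_orthogonal_idempotents_ge_1)
  then obtain c where c: "\<And>m n. m \<noteq> n \<Longrightarrow> 1 / 2 \<le> dist (f m (c m)) (f n (c n))"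
    using exists_separated_selection[of f] by blast

  have norm_q: "norm (q i) \<le> 1" for i
    unfolding norm_bop_eq
  proof (rule onorm_bound)
    show "norm (bop_apply (q i) v) \<le> 1 * norm v" for v
      using cinner_Cauchy_Schwarz[of v "u i"] by (simp add: q_def norm_scaleC norm_u)
  qed simp
  define x :: "'h bop ell_infty" where "x = Bcontfun (\<lambda>n. q (c n))"
  have x: "x n = q (c n)" for n
    unfolding x_def using norm_q by (subst Bcontfun_inverse) (auto intro: bcontfun_normI[of _ 1])
  have "\<phi> x (t n) = f n (c n)" for n
  proof -
    have "f n (c n) = \<phi> (e n) (t n) * \<phi> x (t n)"
      using \<phi>_e(1)[of n x] by (metis f_def e_mult(1) x times_bcontfun.rep_eq)
    then show ?thesis
      by (simp add: e_t)
  qed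
  then have "f n (c n) \<in> range (\<phi> x)" for n
    by (metis rangeI)
  moreover have "compact (range (\<phi> x))"
    by (intro compact_continuous_image compact) simp
  ultimately show False
    using c compact_no_separated_sequence[of "range (\<phi> x)" "\<lambda>n. f n (c n)" "1 / 2"] by simp
qed

theorem corollary3:
  assumes separable: "separable_space (euclidean :: 'h::chilbert_space topology)"
    and infinite_dimensional: "\<And>B :: 'h set. finite B \<Longrightarrow> cspan B \<noteq> UNIV"
  shows "(\<nexists>\<phi> :: 'h bop ell_infty \<Rightarrow> (nat stone_cech \<Rightarrow>\<^sub>C 'h bop).
            bij \<phi> \<and> jordan_homomorphism \<phi>) \<and>
         (\<nexists>\<phi> :: (nat stone_cech \<Rightarrow>\<^sub>C 'h bop) \<Rightarrow> 'h bop ell_infty.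
            bij \<phi> \<and> jordan_homomorphism \<phi>)"
  using no_bijective_jordan_homomorphism_into_compact[OF infinite_dimensional compact_stone_cech]
    jordan_homomorphism_inv bij_imp_bij_inv
  by metis

end
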